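(* Let $A\in\mathbb{R}^{m\times n}$, $b\in\mathbb{R}^m$, $G\in\mathbb{R}^{n\times n}$. Suppose that the polyhedron $P=\{x\in\mathbb{R}^n\mid Ax\le b\}$ is bounded, $\rho(G)<1$, and $E\subseteq P$ is invariant with respect to $G$ and contains the origin in its interior. Then there is a nonnegative integer $t$ such that $\mathcal{S}=I_r(E)$ for all integers $r\ge t$.
   Context: Inequalities between vectors are entrywise. $\rho(G)$ is the spectral radius of $G$. A set $E\subseteq\mathbb{R}^n$ is invariant with respect to $G$ if $x\in E$ implies $Gx\in E$. Define $\mathcal{S}:=\bigcap_{k=0}^{\infty}\{x\in\mathbb{R}^n \mid AG^kx\le b\}$, $S_r:=\bigcap_{k=0}^{r}\{x\in\mathbb{R}^n \mid AG^kx\le b\}$ for integers $r\ge0$, $S_{-1}:=\mathbb{R}^n$, and, for integers $r\ge 0$, $I_r(E):=S_{r-1}\cap\{x\in\mathbb{R}^n\mid G^rx\in E\}$ (so $I_0(E)=E$). *)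

theory Defs
  imports "HOL-Analysis.Analysis"
begin

text \<open>Matrix powers are defined here because the library's \<open>^\<close> and \<open>*\<close> on
  \<open>real ^ 'n ^ 'n\<close> are the entrywise operations.\<close>

primrec matrix_power :: "'a::semiring_1 ^ 'n ^ 'n \<Rightarrow> nat \<Rightarrow> 'a ^ 'n ^ 'n" where
  "matrix_power G 0 = mat 1"
| "matrix_power G (Suc k) = G ** matrix_power G k"

text \<open>The largest modulus of a complex eigenvalue. The spectrum is finite and nonempty, so
  \<open>Max\<close> is well defined; a real matrix is first regarded as a complex one.\<close>

definition matrix_spectrum :: "complex ^ 'n ^ 'n \<Rightarrow> complex set" where
  "matrix_spectrum G = {z. \<exists>v. v \<noteq> 0 \<and> G *v v = z *s v}"

definition matrix_spectral_radius :: "real ^ 'n ^ 'n \<Rightarrow> real" where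
  "matrix_spectral_radius G = Max (norm ` matrix_spectrum (\<chi> i j. complex_of_real (G $ i $ j)))"

definition invariant_under :: "real ^ 'n ^ 'n \<Rightarrow> (real ^ 'n) set \<Rightarrow> bool" where
  "invariant_under G E \<longleftrightarrow> (\<forall>x\<in>E. G *v x \<in> E)"

text \<open>The order \<open>\<le>\<close> on vectors is the library's entrywise order.\<close>

definition S_inf :: "real ^ 'n ^ 'm \<Rightarrow> real ^ 'm \<Rightarrow> real ^ 'n ^ 'n \<Rightarrow> (real ^ 'n) set" where
  "S_inf A b G = (\<Inter>k::nat. {x. (A ** matrix_power G k) *v x \<le> b})"

text \<open>The index is an integer so that \<open>S_trunc A b G (-1)\<close>, an empty intersection, is the
  whole space.\<close>

definition S_trunc :: "real ^ 'n ^ 'm \<Rightarrow> real ^ 'm \<Rightarrow> real ^ 'n ^ 'n \<Rightarrow> int \<Rightarrow> (real ^ 'n) set" where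
  "S_trunc A b G r = (\<Inter>k\<in>{k::nat. int k \<le> r}. {x. (A ** matrix_power G k) *v x \<le> b})"

definition I_set ::
  "real ^ 'n ^ 'm \<Rightarrow> real ^ 'm \<Rightarrow> real ^ 'n ^ 'n \<Rightarrow> (real ^ 'n) set \<Rightarrow> nat \<Rightarrow> (real ^ 'n) set" where
  "I_set A b G E r = S_trunc A b G (int r - 1) \<inter> {x. matrix_power G r *v x \<in> E}"

end

theory Submission
  imports Defs "HOL-Computational_Algebra.Fundamental_Theorem_Algebra"
begin

text \<open>
  Because \<open>\<rho>(G) < 1\<close>, the powers of \<open>G\<close> tend to zero, so from some index \<open>t\<close> on they map the
  bounded polyhedron \<open>P\<close> into the neighbourhood \<open>E\<close> of the origin
  (\<open>matrix_power_eventually_maps_bounded_into_nhd_0\<close>). A point of \<open>S_inf\<close> lies in \<open>P\<close>, hence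
  \<open>G\<^sup>r x \<in> E\<close> for \<open>r \<ge> t\<close>, which is the only condition that \<open>I_r(E)\<close> adds. Conversely, once an orbit
  enters the invariant set \<open>E \<subseteq> P\<close> it satisfies all later constraints, so \<open>I_r(E)\<close> is contained in
  \<open>S_inf\<close> for every \<open>r\<close> (\<open>I_set_subset_S_inf\<close>).

  The analytic content is that \<open>\<rho>(G) < 1\<close> forces \<open>G\<^sup>k x \<longlonglongrightarrow> 0\<close>. Let \<open>M\<close> be \<open>G\<close> as a complex matrix. Its powers live in a finite-dimensional
  space, so some nonzero polynomial \<open>p\<close> annihilates \<open>M\<close>
  (\<open>exists_annihilating_polynomial\<close>). Linear factors \<open>X - a\<close> are split off \<open>p\<close> one
  at a time: if the orbit of \<open>(M - a)v\<close> tends to zero, then so does the orbit of \<open>v\<close>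
  (\<open>orbit_tendsto_0_from_shift\<close>). For \<open>\<bar>a\<bar> < 1\<close> the orbit of \<open>v\<close> satisfies a contracting recurrence
  whose perturbation tends to zero; for \<open>\<bar>a\<bar> \<ge> 1\<close> the number \<open>a\<close> is not an eigenvalue, and the
  inverse of \<open>M - a\<close> carries the one limit to the other.
\<close>

section \<open>Powers of a matrix\<close>

lemma matrix_power_add_vec:
  "matrix_power G (i + j) *v x = matrix_power G i *v (matrix_power G j *v x)"
  for G :: "'a::comm_semiring_1 ^ 'n ^ 'n"
  by (induction i) (simp_all flip: matrix_vector_mul_assoc)

lemma matrix_power_Suc_vec:
  "matrix_power G (Suc k) *v x = G *v (matrix_power G k *v x)"
  "matrix_power G (Suc k) *v x = matrix_power G k *v (G *v x)"
  for G :: "'a::comm_semiring_1 ^ 'n ^ 'n"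
  using matrix_power_add_vec[of G k 1 x] by (simp_all flip: matrix_vector_mul_assoc)

lemma matrix_power_eigenvector:
  fixes G :: "'a::field ^ 'n ^ 'n"
  assumes "G *v v = z *s v"
  shows "matrix_power G k *v v = z ^ k *s v"
  by (induction k)
    (simp_all add: assms vector_scalar_commute vector_smult_assoc mult.commute
      flip: matrix_vector_mul_assoc)

section \<open>An annihilating polynomial\<close>

text \<open>More than \<open>DIM('a)\<close> vectors are linearly dependent. The relation is stated for a sequence, not
  a set, so that repeated vectors count as dependent too.\<close>

lemma exists_vanishing_combination:
  fixes f :: "nat \<Rightarrow> 'a::euclidean_space"
  shows "\<exists>c. (\<exists>i\<le>DIM('a). c i \<noteq> 0) \<and> (\<Sum>i\<le>DIM('a). c i *\<^sub>R f i) = 0"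
proof (cases "inj_on f {..DIM('a)}")
  case True
  then have "card (f ` {..DIM('a)}) = Suc (DIM('a))"
    by (simp add: card_image)
  then have "dependent (f ` {..DIM('a)})"
    using independent_bound[of "f ` {..DIM('a)}"] by auto
  then obtain u w where u: "w \<in> f ` {..DIM('a)}" "u w \<noteq> 0"
    and s: "(\<Sum>y\<in>f ` {..DIM('a)}. u y *\<^sub>R y) = 0"
    by (auto simp: dependent_finite)
  from s have "(\<Sum>i\<le>DIM('a). u (f i) *\<^sub>R f i) = 0"
    by (simp add: sum.reindex[OF True])
  with u show ?thesis by (intro exI[of _ "u \<circ> f"]) auto
next
  case False
  then obtain i j where ij: "i \<le> DIM('a)" "j \<le> DIM('a)" "i \<noteq> j" "f i = f j"
    by (auto simp: inj_on_def)
  define c where "c k = (if k = i then 1 else if k = j then -1 else 0 :: real)" for k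
  have "(\<Sum>k\<le>DIM('a). c k *\<^sub>R f k) = (\<Sum>k\<in>{i, j}. c k *\<^sub>R f k)"
    using ij by (intro sum.mono_neutral_right) (auto simp: c_def)
  also have "\<dots> = 0" using ij by (simp add: c_def)
  finally show ?thesis using ij by (intro exI[of _ c]) (auto simp: c_def)
qed

lemma scaleR_matrix_vec:
  "(c *\<^sub>R X) *v v = complex_of_real c *s (X *v v)"
  by (simp add: vec_eq_iff matrix_vector_mult_def sum_distrib_left)
    (simp add: scaleR_conv_of_real mult.assoc)

text \<open>The matrix powers are vectors of the finite-dimensional real space of complex matrices, so
  they satisfy a linear relation, and its coefficients are those of \<open>p\<close>. The relation
  \<open>p(M) = 0\<close> is stated through its action on vectors, the form in which factors are split off
  later.\<close>

lemma exists_annihilating_polynomial: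
  fixes M :: "complex ^ 'n ^ 'n"
  shows "\<exists>p. p \<noteq> 0 \<and> (\<forall>v. (\<Sum>i\<le>degree p. coeff p i *s (matrix_power M i *v v)) = 0)"
proof -
  let ?N = "DIM(complex ^ 'n ^ 'n)"
  obtain c where c: "\<exists>i\<le>?N. c i \<noteq> 0" "(\<Sum>i\<le>?N. c i *\<^sub>R matrix_power M i) = 0"
    using exists_vanishing_combination[of "matrix_power M"] by blast
  define p where "p = (\<Sum>i\<le>?N. monom (complex_of_real (c i)) i)"
  have cp: "coeff p i = (if i \<le> ?N then complex_of_real (c i) else 0)" for i
    by (simp add: p_def coeff_sum coeff_monom del: DIM_cart)
  then have "p \<noteq> 0" using c(1) by (metis coeff_0 of_real_eq_0_iff)
  have deg: "degree p \<le> ?N" by (rule degree_le) (simp add: cp del: DIM_cart)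
  have "(\<Sum>i\<le>degree p. coeff p i *s (matrix_power M i *v v)) = 0" for v
  proof -
    have "(\<Sum>i\<le>degree p. coeff p i *s (matrix_power M i *v v))
        = (\<Sum>i\<le>?N. coeff p i *s (matrix_power M i *v v))"
      using deg by (intro sum.mono_neutral_left) (auto simp: coeff_eq_0 simp del: DIM_cart)
    also have "\<dots> = (\<Sum>i\<le>?N. (c i *\<^sub>R matrix_power M i) *v v)"
      by (intro sum.cong) (simp_all add: cp scaleR_matrix_vec del: DIM_cart)
    also have "\<dots> = (\<Sum>i\<le>?N. c i *\<^sub>R matrix_power M i) *v v"
    proof -
      have "(\<Sum>i\<in>S. f i *v v) = (\<Sum>i\<in>S. f i) *v v" if "finite S"
        for S and f :: "nat \<Rightarrow> complex ^ 'n ^ 'n"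
        using that by induction (simp_all add: matrix_vector_mult_add_rdistrib)
      from this[OF finite_atMost] show ?thesis .
    qed
    finally show ?thesis by (simp add: c(2) del: DIM_cart)
  qed
  with \<open>p \<noteq> 0\<close> show ?thesis by blast
qed

text \<open>Every eigenvalue is a root of an annihilating polynomial: \<open>0 = p(M) v = p(z) v\<close> for an
  eigenvector \<open>v\<close>. Finiteness is what makes the \<open>Max\<close> in the definition of the spectral radius an
  upper bound of the moduli.\<close>

lemma finite_matrix_spectrum: "finite (matrix_spectrum M)"
proof -
  obtain p where p: "p \<noteq> 0"
    "\<And>v. (\<Sum>i\<le>degree p. coeff p i *s (matrix_power M i *v v)) = 0"
    using exists_annihilating_polynomial[of M] by blast
  have "poly p z = 0" if z: "z \<in> matrix_spectrum M" for z
  proof -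
    obtain v where v: "v \<noteq> 0" "M *v v = z *s v"
      using z by (auto simp: matrix_spectrum_def)
    have "0 = (\<Sum>i\<le>degree p. (coeff p i * z ^ i) *s v)"
      using p(2)[of v] by (simp add: matrix_power_eigenvector[OF v(2)] vector_smult_assoc)
    also have "\<dots> = poly p z *s v"
      by (simp add: poly_altdef vec.scale_sum_left)
    finally show ?thesis using v(1) by simp
  qed
  then have "matrix_spectrum M \<subseteq> {z. poly p z = 0}" by blast
  then show ?thesis using poly_roots_finite[OF p(1)] finite_subset by blast
qed

section \<open>Spectral radius below one\<close>

text \<open>Once \<open>d\<close> is below \<open>(1 - q) \<epsilon>\<close>, the value \<open>\<epsilon>\<close> bounds the fixed point of the recurrence, and
  the excess of \<open>u\<close> over \<open>\<epsilon>\<close> decays geometrically.\<close>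

lemma perturbed_contraction_tendsto_0:
  fixes u d :: "nat \<Rightarrow> real"
  assumes rec: "\<And>k. u (Suc k) \<le> q * u k + d k" and "\<And>k. 0 \<le> u k"
    and q: "0 \<le> q" "q < 1" and d: "d \<longlonglongrightarrow> 0"
  shows "u \<longlonglongrightarrow> 0"
proof (rule LIMSEQ_I)
  fix e :: real assume e: "e > 0"
  have "(1 - q) * (e / 2) > 0" using q e by simp
  from LIMSEQ_D[OF d this] obtain N where N: "\<And>k. k \<ge> N \<Longrightarrow> \<bar>d k\<bar> < (1 - q) * (e / 2)"
    by auto
  have geo: "u (N + k) \<le> q ^ k * u N + e / 2" for k
  proof (induction k)
    case (Suc k)
    have "u (N + Suc k) \<le> q * u (N + k) + d (N + k)" using rec[of "N + k"] by simp
    also have "\<dots> \<le> q * (q ^ k * u N + e / 2) + (1 - q) * (e / 2)"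
      using Suc N[of "N + k"] q by (intro add_mono mult_left_mono) auto
    also have "\<dots> = q ^ Suc k * u N + e / 2"
      by (simp add: algebra_simps diff_divide_distrib)
    finally show ?case .
  qed (use e in simp)
  have "(\<lambda>k. q ^ k * u N) \<longlonglongrightarrow> 0 * u N"
    by (intro tendsto_intros LIMSEQ_realpow_zero q)
  then have "\<exists>K. \<forall>k\<ge>K. norm (q ^ k * u N - 0) < e / 2"
    using LIMSEQ_D[of "\<lambda>k. q ^ k * u N" 0 "e / 2"] e by simp
  then obtain K where K: "\<And>k. k \<ge> K \<Longrightarrow> \<bar>q ^ k * u N\<bar> < e / 2" by auto
  have "norm (u n - 0) < e" if "n \<ge> N + K" for n
  proof -
    have "u n \<le> q ^ (n - N) * u N + e / 2" using geo[of "n - N"] that by simp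
    moreover have "\<bar>q ^ (n - N) * u N\<bar> < e / 2" using K[of "n - N"] that by simp
    ultimately show ?thesis using assms(2)[of n] unfolding real_norm_def by linarith
  qed
  then show "\<exists>n0. \<forall>n\<ge>n0. norm (u n - 0) < e" by blast
qed

lemma tendsto_matrix_vector_mult_0:
  fixes B :: "complex ^ 'n ^ 'm"
  assumes "(f \<longlongrightarrow> 0) F"
  shows "((\<lambda>k. B *v f k) \<longlongrightarrow> 0) F"
proof (rule vec_tendstoI)
  fix i
  have "((\<lambda>k. \<Sum>j\<in>UNIV. B $ i $ j * f k $ j) \<longlongrightarrow> (\<Sum>j\<in>UNIV. B $ i $ j * (0 :: complex ^ 'n) $ j)) F"
    by (intro tendsto_intros assms)
  then show "((\<lambda>k. (B *v f k) $ i) \<longlongrightarrow> 0 $ i) F"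
    by (simp add: matrix_vector_mult_def)
qed

text \<open>One linear factor \<open>X - a\<close> is removed here, and this is the only step that uses the location of
  the spectrum. With \<open>x\<^sub>k = M\<^sup>k v\<close> and \<open>e\<^sub>k = M\<^sup>k (M - a) v\<close> one has \<open>x\<^sub>k\<^sub>+\<^sub>1 = a x\<^sub>k + e\<^sub>k\<close>, which
  settles the case \<open>\<bar>a\<bar> < 1\<close>. Otherwise \<open>M - a\<close> has a left inverse \<open>B\<close>, and
  \<open>x\<^sub>k = B e\<^sub>k\<close> because \<open>M - a\<close> commutes with the powers of \<open>M\<close>.\<close>

lemma orbit_tendsto_0_from_shift:
  fixes M :: "complex ^ 'n ^ 'n"
  assumes spec: "\<And>z. z \<in> matrix_spectrum M \<Longrightarrow> norm z < 1"
    and shift: "(\<lambda>k. matrix_power M k *v (M *v v - a *s v)) \<longlonglongrightarrow> 0"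
  shows "(\<lambda>k. matrix_power M k *v v) \<longlonglongrightarrow> 0"
proof (cases "norm a < 1")
  case True
  let ?x = "\<lambda>k. matrix_power M k *v v"
  let ?e = "\<lambda>k. matrix_power M k *v (M *v v - a *s v)"
  have rec: "?x (Suc k) = a *s ?x k + ?e k" for k
    by (simp add: matrix_power_Suc_vec(2) matrix_vector_mult_diff_distrib vector_scalar_commute
        del: matrix_power.simps)
  show ?thesis
  proof (rule vec_tendstoI)
    fix i
    have "(\<lambda>k. norm (?x k $ i)) \<longlonglongrightarrow> 0"
    proof (rule perturbed_contraction_tendsto_0)
      show "norm (?x (Suc k) $ i) \<le> norm a * norm (?x k $ i) + norm (?e k $ i)" for k
        unfolding rec using norm_triangle_ineq[of "a * ?x k $ i" "?e k $ i"]
        by (simp add: norm_mult)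
      show "(\<lambda>k. norm (?e k $ i)) \<longlonglongrightarrow> 0"
        using tendsto_norm[OF tendsto_vec_nth[OF shift, of i]] by simp
    qed (use True in auto)
    then show "(\<lambda>k. ?x k $ i) \<longlonglongrightarrow> 0 $ i"
      by (simp add: tendsto_norm_zero_iff)
  qed
next
  case False
  let ?D = "M - mat a"
  have D: "?D *v w = M *v w - a *s w" for w
    by (simp add: vec_eq_iff matrix_vector_mult_def mat_def left_diff_distrib sum_subtractf
        mult_delta_left)
  have "w = 0" if "?D *v w = 0" for w
    using that spec[of a] False by (auto simp: D matrix_spectrum_def)
  then obtain B where B: "B ** ?D = mat 1"
    using matrix_left_invertible_ker[of ?D] by blast
  have "?D *v (matrix_power M k *v v) = matrix_power M k *v (M *v v - a *s v)" for k
    unfolding D by (simp add: matrix_vector_mult_diff_distrib vector_scalar_commute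
        flip: matrix_power_Suc_vec del: matrix_power.simps)
  then have "matrix_power M k *v v = B *v (matrix_power M k *v (M *v v - a *s v))" for k
    using B by (metis matrix_vector_mul_assoc matrix_vector_mul_lid)
  then show ?thesis using tendsto_matrix_vector_mult_0[OF shift, of B] by simp
qed

text \<open>Induction on the degree: writing \<open>p = (X - a) q\<close>, the polynomial \<open>q\<close> annihilates
  \<open>(M - a) v\<close>, whose orbit therefore tends to zero. The vector has to vary in the induction.\<close>

lemma orbit_tendsto_0_of_annihilated:
  fixes M :: "complex ^ 'n ^ 'n"
  assumes spec: "\<And>z. z \<in> matrix_spectrum M \<Longrightarrow> norm z < 1"
    and "p \<noteq> 0" "(\<Sum>i\<le>degree p. coeff p i *s (matrix_power M i *v v)) = 0"
  shows "(\<lambda>k. matrix_power M k *v v) \<longlonglongrightarrow> 0"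
  using assms(2,3)
proof (induction "degree p" arbitrary: p v)
  case 0
  then have "coeff p 0 \<noteq> 0" by (metis leading_coeff_0_iff)
  with 0 have "v = 0" by simp
  then show ?case by simp
next
  case (Suc n)
  then obtain a where "poly p a = 0"
    using fundamental_theorem_of_algebra[of p] by (metis constant_degree nat.distinct(1))
  then obtain q where q: "p = [:- a, 1:] * q"
    by (auto simp: poly_eq_0_iff_dvd)
  have q0: "q \<noteq> 0" using Suc.prems q by auto
  have dq: "degree q = n" using Suc.hyps(2) q0
    unfolding q by (subst (asm) degree_mult_eq) auto
  have dp: "degree p = Suc n" using Suc.hyps(2) by simp
  \<comment> \<open>The computation below is \<open>q(M) (M - a) v = p(M) v\<close>, coefficient by coefficient.\<close>
  let ?x = "\<lambda>i. matrix_power M i *v v"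
  have x: "matrix_power M i *v (M *v v - a *s v) = ?x (Suc i) - a *s ?x i" for i
    by (simp add: matrix_power_Suc_vec(2) matrix_vector_mult_diff_distrib vector_scalar_commute
        del: matrix_power.simps)
  have "(\<Sum>i\<le>n. coeff q i *s (matrix_power M i *v (M *v v - a *s v)))
      = (\<Sum>i\<le>n. coeff q i *s ?x (Suc i)) - (\<Sum>i\<le>n. (a * coeff q i) *s ?x i)"
    unfolding x by (simp add: vector_ssub_ldistrib vector_smult_assoc mult.commute
        sum_subtractf del: matrix_power.simps)
  also have "(\<Sum>i\<le>n. coeff q i *s ?x (Suc i)) = (\<Sum>i\<le>Suc n. coeff (pCons 0 q) i *s ?x i)"
    by (subst sum.atMost_Suc_shift) (simp del: matrix_power.simps)
  also have "(\<Sum>i\<le>n. (a * coeff q i) *s ?x i) = (\<Sum>i\<le>Suc n. (a * coeff q i) *s ?x i)"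
    using dq by (simp add: coeff_eq_0 del: matrix_power.simps)
  also have "(\<Sum>i\<le>Suc n. coeff (pCons 0 q) i *s ?x i) - (\<Sum>i\<le>Suc n. (a * coeff q i) *s ?x i)
      = (\<Sum>i\<le>Suc n. coeff p i *s ?x i)"
    unfolding sum_subtractf[symmetric] q
    by (intro sum.cong) (simp_all add: vec_eq_iff algebra_simps del: matrix_power.simps)
  also have "\<dots> = 0" using Suc.prems(2) by (simp only: dp)
  finally have "(\<lambda>k. matrix_power M k *v (M *v v - a *s v)) \<longlonglongrightarrow> 0"
    using Suc.hyps(1)[of q] dq q0 by simp
  then show ?case by (rule orbit_tendsto_0_from_shift[rotated]) (rule spec)
qed

lemma complexified_matrix_power_vec:
  "matrix_power (\<chi> i j. complex_of_real (G $ i $ j)) k *v (\<chi> i. complex_of_real (x $ i))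
    = (\<chi> i. complex_of_real ((matrix_power G k *v x) $ i))"
proof (induction k)
  case (Suc k)
  then show ?case
    by (simp only: matrix_power_Suc_vec(1)) (simp add: vec_eq_iff matrix_vector_mult_def)
qed (simp add: vec_eq_iff)

lemma matrix_power_vec_tendsto_0:
  assumes "matrix_spectral_radius G < 1"
  shows "(\<lambda>k. matrix_power G k *v x) \<longlonglongrightarrow> 0"
proof -
  let ?M = "\<chi> i j. complex_of_real (G $ i $ j)"
  let ?v = "\<chi> i. complex_of_real (x $ i)"
  have "norm z < 1" if "z \<in> matrix_spectrum ?M" for z
  proof -
    have "norm z \<le> matrix_spectral_radius G"
      unfolding matrix_spectral_radius_def
      using that finite_matrix_spectrum by (intro Max_ge) auto
    with assms show ?thesis by simp
  qed
  then have lim: "(\<lambda>k. matrix_power ?M k *v ?v) \<longlonglongrightarrow> 0"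
    using exists_annihilating_polynomial[of ?M] orbit_tendsto_0_of_annihilated[of ?M] by blast
  show ?thesis
  proof (rule vec_tendstoI)
    fix i
    have "(\<lambda>k. complex_of_real ((matrix_power G k *v x) $ i)) \<longlonglongrightarrow> complex_of_real 0"
      using tendsto_vec_nth[OF lim, of i] by (simp add: complexified_matrix_power_vec)
    then show "(\<lambda>k. (matrix_power G k *v x) $ i) \<longlonglongrightarrow> 0 $ i"
      by (simp only: tendsto_of_real_iff zero_index)
  qed
qed

text \<open>Convergence on the finitely many basis vectors makes the convergence of the powers uniform on
  bounded sets, so one index \<open>t\<close> serves all points of \<open>P\<close>.\<close>

lemma matrix_power_eventually_maps_bounded_into_nhd_0:
  fixes G :: "real ^ 'n ^ 'n"
  assumes "matrix_spectral_radius G < 1" "bounded P" "0 \<in> interior E"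
  shows "\<exists>t. \<forall>k\<ge>t. \<forall>x\<in>P. matrix_power G k *v x \<in> E"
proof -
  obtain e where e: "e > 0" "ball 0 e \<subseteq> E" using assms(3) mem_interior by blast
  obtain R where R: "\<And>x. x \<in> P \<Longrightarrow> norm x \<le> R" using assms(2) bounded_iff by blast
  have "(\<lambda>k. \<Sum>j\<in>UNIV. R * norm (matrix_power G k *v axis j 1)) \<longlonglongrightarrow>
      (\<Sum>j\<in>(UNIV :: 'n set). R * norm (0 :: real ^ 'n))"
    by (intro tendsto_intros matrix_power_vec_tendsto_0 assms(1))
  then have "\<forall>\<^sub>F k in sequentially. (\<Sum>j\<in>UNIV. R * norm (matrix_power G k *v axis j 1)) < e"
    using e(1) by (intro order_tendstoD(2)) auto
  then obtain t where t: "\<And>k. k \<ge> t \<Longrightarrow> (\<Sum>j\<in>UNIV. R * norm (matrix_power G k *v axis j 1)) < e"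
    by (auto simp: eventually_sequentially)
  have "matrix_power G k *v x \<in> E" if "k \<ge> t" "x \<in> P" for k x
  proof -
    have "matrix_power G k *v x = matrix_power G k *v (\<Sum>j\<in>UNIV. x $ j *s axis j 1)"
      by (simp only: basis_expansion)
    also have "\<dots> = (\<Sum>j\<in>UNIV. matrix_power G k *v (x $ j *s axis j 1))"
      by (rule linear_sum[OF matrix_vector_mul_linear])
    also have "\<dots> = (\<Sum>j\<in>UNIV. x $ j *\<^sub>R (matrix_power G k *v axis j 1))"
      by (simp only: scalar_mult_eq_scaleR matrix_vector_mult_scaleR)
    also have "norm \<dots> \<le> (\<Sum>j\<in>UNIV. R * norm (matrix_power G k *v axis j 1))"
      using order_trans[OF component_le_norm_cart R[OF that(2)]]
      by (intro sum_norm_le) (auto intro: mult_right_mono)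
    finally show ?thesis using t[OF that(1)] e(2) by auto
  qed
  then show ?thesis by blast
qed

section \<open>Constraint sets\<close>

lemma invariant_under_matrix_power:
  assumes "invariant_under G E" "x \<in> E"
  shows "matrix_power G k *v x \<in> E"
  using assms
  by (induction k) (auto simp: invariant_under_def simp flip: matrix_vector_mul_assoc)

lemma mem_S_inf_iff: "x \<in> S_inf A b G \<longleftrightarrow> (\<forall>k. A *v (matrix_power G k *v x) \<le> b)"
  by (auto simp: S_inf_def simp flip: matrix_vector_mul_assoc)

lemma mem_I_set_iff:
  "x \<in> I_set A b G E r \<longleftrightarrow>
    (\<forall>k<r. A *v (matrix_power G k *v x) \<le> b) \<and> matrix_power G r *v x \<in> E"
  by (auto simp: I_set_def S_trunc_def simp flip: matrix_vector_mul_assoc)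

text \<open>Constraints of index below \<open>r\<close> are part of \<open>I_set\<close>; for \<open>k \<ge> r\<close>, invariance keeps
  \<open>G\<^sup>k x = G\<^sup>k\<^sup>-\<^sup>r (G\<^sup>r x)\<close> inside \<open>E\<close>.\<close>

lemma I_set_subset_S_inf:
  assumes "E \<subseteq> {x. A *v x \<le> b}" "invariant_under G E"
  shows "I_set A b G E r \<subseteq> S_inf A b G"
proof
  fix x assume x: "x \<in> I_set A b G E r"
  have "A *v (matrix_power G k *v x) \<le> b" for k
  proof (cases "k < r")
    case True
    then show ?thesis using x by (simp add: mem_I_set_iff)
  next
    case False
    then have "matrix_power G k *v x = matrix_power G (k - r) *v (matrix_power G r *v x)"
      by (simp flip: matrix_power_add_vec)
    then show ?thesis
      using x invariant_under_matrix_power[OF assms(2)] assms(1) by (auto simp: mem_I_set_iff)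
  qed
  then show "x \<in> S_inf A b G" by (simp add: mem_S_inf_iff)
qed

theorem corollary2p10:
  fixes A :: "real ^ 'n ^ 'm" and b :: "real ^ 'm" and G :: "real ^ 'n ^ 'n"
    and E :: "(real ^ 'n) set"
  assumes "bounded {x. A *v x \<le> b}"
    and "matrix_spectral_radius G < 1"
    and "E \<subseteq> {x. A *v x \<le> b}"
    and "invariant_under G E"
    and "0 \<in> interior E"
  shows "\<exists>t::nat. \<forall>r\<ge>t. S_inf A b G = I_set A b G E r"
proof -
  obtain t where t: "\<And>r x. r \<ge> t \<Longrightarrow> A *v x \<le> b \<Longrightarrow> matrix_power G r *v x \<in> E"
    using matrix_power_eventually_maps_bounded_into_nhd_0[OF assms(2,1,5)] by auto
  have "S_inf A b G \<subseteq> I_set A b G E r" if "r \<ge> t" for r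
  proof
    fix x assume x: "x \<in> S_inf A b G"
    then have "A *v (matrix_power G 0 *v x) \<le> b" unfolding mem_S_inf_iff by blast
    with x show "x \<in> I_set A b G E r"
      using t[OF that, of x] by (auto simp: mem_S_inf_iff mem_I_set_iff)
  qed
  then show ?thesis using I_set_subset_S_inf[OF assms(3,4)] by blast
qed

end
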